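(* Let ${\preceq},{\preceq'}\in\mathrm{WO}(N)$, assume that $A_K^{t,\Phi}$ is multiplicative on $\{{\preceq},{\preceq'}\}$, and let $L$ be a left ideal of $A$ with $\mathrm{LM}_{\preceq}(L)\subseteq\mathrm{LM}_{\preceq'}(L)$. Then $\mathrm{LM}_{\preceq}(L)=\mathrm{LM}_{\preceq'}(L)$.
   Context: An algebra of countable type $A_K^{t,\Phi}=(A,K,t,\Phi)$ consists of an associative unital, not necessarily commutative algebra $A$ over a field $K$, a nonnegative integer $t$, and a $K$-module isomorphism $\Phi:A\to K[X]=K[X_1,\dots,X_t]$ (commutative polynomial ring; $\Phi$ need not be multiplicative). $M=\{X^\nu\mid\nu\in\mathbb{N}_0^t\}$ is the set of monomials and $N=\Phi^{-1}(M)$ is the canonical $K$-basis of $A$. For a set $S$, $\mathrm{TO}(S)$ is the set of all total orderings on $S$ (antisymmetric, transitive, total binary relations) and $\mathrm{WO}(S)\subseteq\mathrm{TO}(S)$ the set of those that are well-orderings. Let $\phi:\mathrm{TO}(N)\to\mathrm{TO}(M)$ be the bijection given by $\Phi(n)\,\phi({\preceq})\,\Phi(n')\Leftrightarrow n\preceq n'$. For ${\preceq}\in\mathrm{TO}(N)$ and $a\in A\setminus\{0\}$, $\mathrm{LM}_\preceq(a)\in M$ is the $\phi({\preceq})$-maximal monomial occurring in $\Phi(a)$ with nonzero coefficient. For $H\subseteq A$, $\mathrm{LM}_\preceq(H)$ is the ideal of $K[X]$ generated by $\{\mathrm{LM}_\preceq(h)\mid h\in H\setminus\{0\}\}$. For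 $\mathfrak{T}\subseteq\mathrm{TO}(N)$, $A_K^{t,\Phi}$ is multiplicative on $\mathfrak{T}$ if $A$ is a domain and $\mathrm{LM}_\preceq(ab)=\mathrm{LM}_\preceq(a)\mathrm{LM}_\preceq(b)$ for all $a,b\in A\setminus\{0\}$ and all ${\preceq}\in\mathfrak{T}$. *)

theory Defs
  imports Complex_Main "HOL-Library.Poly_Mapping" "HOL-Algebra.Ideal"
begin

section \<open>Polynomials in \<open>X\<^sub>0, \<dots>, X\<^sub>t\<^sub>-\<^sub>1\<close>\<close>

text \<open>An exponent vector is a finitely supported function on variable indices; the
  variables \<open>X\<^sub>1, \<dots>, X\<^sub>t\<close> are indexed by \<open>0, \<dots>, t - 1\<close>. Indexing by a subset of
  \<^typ>\<open>nat\<close> instead of by a finite type keeps the case \<open>t = 0\<close>. The product of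
  \<^type>\<open>poly_mapping\<close> is convolution, i.e. polynomial multiplication.\<close>

type_synonym 'k mpoly = "(nat \<Rightarrow>\<^sub>0 nat) \<Rightarrow>\<^sub>0 'k"

definition exponents :: "nat \<Rightarrow> (nat \<Rightarrow>\<^sub>0 nat) set" where
  "exponents t = {\<nu>. Poly_Mapping.keys \<nu> \<subseteq> {..<t}}"

definition polys :: "nat \<Rightarrow> 'k::field mpoly set" where
  "polys t = {p. Poly_Mapping.keys p \<subseteq> exponents t}"

definition poly_ring :: "nat \<Rightarrow> 'k::field mpoly ring" where
  "poly_ring t = \<lparr>carrier = polys t, monoid.mult = (*), one = 1, zero = 0, add = (+)\<rparr>"

definition poly_scale :: "'k::field \<Rightarrow> 'k mpoly \<Rightarrow> 'k mpoly" where
  "poly_scale c p = Poly_Mapping.single 0 c * p"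

definition monomial :: "(nat \<Rightarrow>\<^sub>0 nat) \<Rightarrow> 'k::field mpoly" where
  "monomial \<nu> = Poly_Mapping.single \<nu> 1"

definition monomials :: "nat \<Rightarrow> 'k::field mpoly set" where
  "monomials t = monomial ` exponents t"

lemma zero_in_polys: "0 \<in> polys t"
  by (simp add: polys_def)

lemma one_in_polys: "1 \<in> polys t"
  by (simp add: polys_def exponents_def)

lemma add_in_polys: "p \<in> polys t \<Longrightarrow> q \<in> polys t \<Longrightarrow> p + q \<in> polys t"
  using Poly_Mapping.keys_add[of p q] by (auto simp: polys_def)

lemma uminus_in_polys: "p \<in> polys t \<Longrightarrow> - p \<in> polys t"
  by (simp add: polys_def)

lemma add_in_exponents: "\<mu> \<in> exponents t \<Longrightarrow> \<nu> \<in> exponents t \<Longrightarrow> \<mu> + \<nu> \<in> exponents t"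
  using Poly_Mapping.keys_add[of \<mu> \<nu>] by (auto simp: exponents_def)

lemma mult_in_polys: "p \<in> polys t \<Longrightarrow> q \<in> polys t \<Longrightarrow> p * q \<in> polys t"
  using Poly_Mapping.keys_mult[of p q] add_in_exponents unfolding polys_def by blast

lemma cring_poly_ring: "cring (poly_ring t :: 'k::field mpoly ring)"
proof (rule cringI)
  show "abelian_group (poly_ring t :: 'k mpoly ring)"
  proof (rule abelian_groupI)
    fix p :: "'k mpoly" assume "p \<in> carrier (poly_ring t)"
    then show "\<exists>q\<in>carrier (poly_ring t). q \<oplus>\<^bsub>poly_ring t\<^esub> p = \<zero>\<^bsub>poly_ring t\<^esub>"
      by (intro bexI[of _ "- p"]) (simp_all add: poly_ring_def uminus_in_polys)
  qed (simp_all add: poly_ring_def zero_in_polys add_in_polys ac_simps)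
  show "Group.comm_monoid (poly_ring t :: 'k mpoly ring)"
    by (rule comm_monoidI) (simp_all add: poly_ring_def one_in_polys mult_in_polys ac_simps)
qed (simp add: poly_ring_def distrib_right)

lemma vector_space_poly_scale: "vector_space poly_scale"
proof
  fix a b :: 'a and x :: "'a mpoly"
  have eq: "Poly_Mapping.single 0 a * Poly_Mapping.single 0 b =
      (Poly_Mapping.single 0 (a * b) :: 'a mpoly)"
    by (simp add: mult_single)
  show "poly_scale a (poly_scale b x) = poly_scale (a * b) x"
    unfolding poly_scale_def mult.assoc[symmetric] eq ..
qed (simp_all add: poly_scale_def distrib_left distrib_right single_add)

section \<open>Algebras of countable type\<close>

text \<open>\<^const>\<open>Vector_Spaces.linear\<close> includes that both scalar multiplications are vector space
  structures. Requiring \<open>1 \<noteq> 0\<close> in \<open>A\<close> (class \<^class>\<open>ring_1\<close>) loses nothing: \<open>A\<close> is isomorphic to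
  \<open>K[X]\<close> as a vector space, hence nonzero.\<close>

locale algebra_of_countable_type =
  fixes scale :: "'k::field \<Rightarrow> 'a::ring_1 \<Rightarrow> 'a"
    and t :: nat
    and \<Phi> :: "'a \<Rightarrow> 'k mpoly"
  assumes linear_\<Phi>: "Vector_Spaces.linear scale poly_scale \<Phi>"
    and bij_\<Phi>: "bij_betw \<Phi> UNIV (polys t)"
    and scale_mult_left: "scale c (a * b) = scale c a * b"
    and scale_mult_right: "scale c (a * b) = a * scale c b"

definition canonical_basis :: "nat \<Rightarrow> ('a \<Rightarrow> 'k::field mpoly) \<Rightarrow> 'a set" where
  "canonical_basis t \<Phi> = \<Phi> -` monomials t"

text \<open>The ordering \<open>\<phi>(\<preceq>)\<close> of the monomials. Orderings are sets of pairs,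
  \<open>(n, n') \<in> r\<close> standing for \<open>n \<preceq> n'\<close>.\<close>

definition transport_order :: "('a \<Rightarrow> 'k mpoly) \<Rightarrow> 'a rel \<Rightarrow> 'k mpoly rel" where
  "transport_order \<Phi> r = {(\<Phi> n, \<Phi> n') | n n'. (n, n') \<in> r}"

definition occurring_monomials :: "'k::field mpoly \<Rightarrow> 'k mpoly set" where
  "occurring_monomials p = monomial ` Poly_Mapping.keys p"

text \<open>Meaningful only for \<open>a \<noteq> 0\<close> and a linear order \<open>r\<close> on the canonical basis;
  see \<open>LM_greatest\<close> below.\<close>

definition LM :: "('a \<Rightarrow> 'k::field mpoly) \<Rightarrow> 'a rel \<Rightarrow> 'a \<Rightarrow> 'k mpoly" where
  "LM \<Phi> r a = (THE m. m \<in> occurring_monomials (\<Phi> a) \<and>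
     (\<forall>m'\<in>occurring_monomials (\<Phi> a). (m', m) \<in> transport_order \<Phi> r))"

definition LM_ideal ::
    "nat \<Rightarrow> ('a::zero \<Rightarrow> 'k::field mpoly) \<Rightarrow> 'a rel \<Rightarrow> 'a set \<Rightarrow> 'k mpoly set" where
  "LM_ideal t \<Phi> r H = Idl\<^bsub>poly_ring t\<^esub> {LM \<Phi> r h | h. h \<in> H \<and> h \<noteq> 0}"

definition multiplicative_on ::
    "('a::ring_1 \<Rightarrow> 'k::field mpoly) \<Rightarrow> 'a rel set \<Rightarrow> bool" where
  "multiplicative_on \<Phi> T \<longleftrightarrow>
     (\<forall>a b :: 'a. a * b = 0 \<longrightarrow> a = 0 \<or> b = 0) \<and>
     (\<forall>r\<in>T. \<forall>a b. a \<noteq> 0 \<longrightarrow> b \<noteq> 0 \<longrightarrow> LM \<Phi> r (a * b) = LM \<Phi> r a * LM \<Phi> r b)"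

definition left_ideal :: "'a::ring_1 set \<Rightarrow> bool" where
  "left_ideal L \<longleftrightarrow>
     0 \<in> L \<and> (\<forall>x\<in>L. \<forall>y\<in>L. x + y \<in> L) \<and> (\<forall>a. \<forall>x\<in>L. a * x \<in> L)"

context algebra_of_countable_type
begin

lemma linear_order_transport:
  assumes "linear_order_on (canonical_basis t \<Phi>) r"
  shows "linear_order_on (monomials t) (transport_order \<Phi> r)"
proof -
  have inj: "\<Phi> x = \<Phi> y \<longleftrightarrow> x = y" for x y
    using bij_\<Phi> by (simp add: bij_betw_def inj_eq)
  have "monomials t \<subseteq> (polys t :: 'k mpoly set)"
    by (simp add: monomials_def monomial_def polys_def image_subset_iff)
  then have M: "monomials t = \<Phi> ` canonical_basis t \<Phi>"
    using bij_\<Phi> by (simp add: bij_betw_def canonical_basis_def image_vimage_eq Int_absorb2)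
  have mem: "(\<Phi> x, \<Phi> y) \<in> transport_order \<Phi> r \<longleftrightarrow> (x, y) \<in> r" for x y
    by (auto simp: transport_order_def inj)
  have r: "r \<subseteq> canonical_basis t \<Phi> \<times> canonical_basis t \<Phi>" "refl_on (canonical_basis t \<Phi>) r"
      "trans r" "antisym r" "total_on (canonical_basis t \<Phi>) r"
    using assms by (simp_all add: order_on_defs)
  have "transport_order \<Phi> r \<subseteq> monomials t \<times> monomials t"
    using r(1) unfolding M transport_order_def by blast
  moreover have "refl_on (monomials t) (transport_order \<Phi> r)"
    using r(2) by (simp add: refl_on_def M mem)
  moreover have "total_on (monomials t) (transport_order \<Phi> r)"
    using r(5) by (simp add: total_on_def M mem inj)
  moreover have "trans (transport_order \<Phi> r)"
  proof (rule transI)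
    fix x y z assume xyz: "(x, y) \<in> transport_order \<Phi> r" "(y, z) \<in> transport_order \<Phi> r"
    then obtain x' y' z' where "x = \<Phi> x'" "y = \<Phi> y'" "z = \<Phi> z'"
      unfolding transport_order_def by blast
    then show "(x, z) \<in> transport_order \<Phi> r"
      using xyz transD[OF r(3), of x' y' z'] by (simp add: mem)
  qed
  moreover have "antisym (transport_order \<Phi> r)"
  proof (rule antisymI)
    fix x y assume xy: "(x, y) \<in> transport_order \<Phi> r" "(y, x) \<in> transport_order \<Phi> r"
    then obtain x' y' where "x = \<Phi> x'" "y = \<Phi> y'"
      unfolding transport_order_def by blast
    then show "x = y"
      using xy antisymD[OF r(4), of x' y'] by (simp add: mem)
  qed
  ultimately show ?thesis
    by (simp add: order_on_defs)
qed

lemma LM_greatest: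
  assumes lin: "linear_order_on (canonical_basis t \<Phi>) r" and "a \<noteq> 0"
  shows "LM \<Phi> r a \<in> occurring_monomials (\<Phi> a)"
    and "m \<in> occurring_monomials (\<Phi> a) \<Longrightarrow> (m, LM \<Phi> r a) \<in> transport_order \<Phi> r"
proof -
  let ?S = "occurring_monomials (\<Phi> a)" and ?R = "transport_order \<Phi> r"
  have R: "linear_order_on (monomials t) ?R"
    by (rule linear_order_transport[OF lin])
  interpret \<Phi>: Vector_Spaces.linear scale poly_scale \<Phi>
    by (rule linear_\<Phi>)
  have "\<Phi> a \<noteq> 0"
    using \<open>a \<noteq> 0\<close> bij_\<Phi> \<Phi>.zero by (metis bij_betw_def injD)
  then have ne: "?S \<noteq> {}"
    by (simp add: occurring_monomials_def)
  have fin: "finite ?S"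
    by (simp add: occurring_monomials_def)
  have "\<Phi> a \<in> polys t"
    using bij_\<Phi> by (auto simp: bij_betw_def)
  then have sub: "?S \<subseteq> monomials t"
    by (auto simp: occurring_monomials_def monomials_def polys_def)
  have "\<exists>m\<in>?S. \<forall>m'\<in>?S. (m', m) \<in> ?R"
    using fin ne sub
  proof (induction rule: finite_ne_induct)
    case (singleton x)
    then show ?case
      using R by (auto simp: order_on_defs refl_on_def)
  next
    case (insert x F)
    then obtain m where m: "m \<in> F" "\<And>m'. m' \<in> F \<Longrightarrow> (m', m) \<in> ?R"
      by auto
    have x: "(x, x) \<in> ?R" "(x, m) \<in> ?R \<or> (m, x) \<in> ?R"
      using R insert.prems insert.hyps m(1)
      by (auto simp: order_on_defs refl_on_def total_on_def)
    show ?case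
      using x m R unfolding order_on_defs trans_def by (metis insert_iff)
  qed
  then have "\<exists>!m. m \<in> ?S \<and> (\<forall>m'\<in>?S. (m', m) \<in> ?R)"
    using R by (auto simp: order_on_defs antisym_def)
  from theI'[OF this] show "LM \<Phi> r a \<in> ?S" "m \<in> ?S \<Longrightarrow> (m, LM \<Phi> r a) \<in> ?R"
    unfolding LM_def by blast+
qed

end

end

(* Multiplicativity makes the leading monomials of L closed under multiplication by monomials, so
   LM(L) is spanned by them. Suppose some X^\<mu> is a \<preceq>'-leading but not a \<preceq>-leading monomial of L.
   Division with respect to the well-ordering \<preceq>' gives f \<in> L whose support consists of X^\<mu> and of
   monomials outside LM_\<preceq>'(L), hence outside LM_\<preceq>(L). Then f is nonzero, but its \<preceq>-leading
   monomial is not in LM_\<preceq>(L), a contradiction. *)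

theory Submission
  imports Defs
begin

section \<open>Monomials, and ideals of polynomials with restricted support\<close>

lemma lookup_poly_scale [simp]:
  "Poly_Mapping.lookup (poly_scale c p) \<nu> = c * Poly_Mapping.lookup p \<nu>"
  unfolding poly_scale_def mult_map_scale_conv_mult[symmetric] by (simp add: Poly_Mapping.map.rep_eq when_def)

lemma keys_monomial [simp]: "Poly_Mapping.keys (monomial \<nu> :: 'k::field mpoly) = {\<nu>}"
  by (simp add: monomial_def)

lemma monomial_inject [simp]: "(monomial \<mu> :: 'k::field mpoly) = monomial \<nu> \<longleftrightarrow> \<mu> = \<nu>"
  by (metis keys_monomial singleton_inject)

lemma monomial_add: "monomial (\<mu> + \<nu>) = (monomial \<mu> * monomial \<nu> :: 'k::field mpoly)"
  by (simp add: monomial_def mult_single)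

lemma monomial_in_polys: "monomial \<nu> \<in> polys t \<longleftrightarrow> \<nu> \<in> exponents t"
  by (simp add: polys_def)

text \<open>Every exponent of a product is a sum of exponents of the factors, so the closure of
  \<open>E\<close> yields absorption. This serves as an upper bound for ideals generated by
  monomials.\<close>

lemma ideal_polys_supported_on:
  assumes sub: "E \<subseteq> exponents t"
    and closed: "\<And>\<mu> \<nu>. \<mu> \<in> exponents t \<Longrightarrow> \<nu> \<in> E \<Longrightarrow> \<mu> + \<nu> \<in> E"
  shows "ideal {p. Poly_Mapping.keys p \<subseteq> E} (poly_ring t :: 'k::field mpoly ring)"
proof -
  interpret cring "poly_ring t :: 'k mpoly ring"
    by (rule cring_poly_ring)
  let ?I = "{p :: 'k mpoly. Poly_Mapping.keys p \<subseteq> E}"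
  have polys: "?I \<subseteq> polys t"
    using sub by (auto simp: polys_def)
  have mult: "q * p \<in> ?I" if "p \<in> ?I" "q \<in> polys t" for p q :: "'k mpoly"
    using that Poly_Mapping.keys_mult[of q p] closed unfolding polys_def by blast
  show ?thesis
  proof (rule idealI)
    show "ring (poly_ring t :: 'k mpoly ring)"
      by (rule ring_axioms)
    show "subgroup ?I (add_monoid (poly_ring t :: 'k mpoly ring))"
    proof (rule add.subgroupI)
      show "?I \<subseteq> carrier (poly_ring t)"
        using polys by (simp add: poly_ring_def)
      show "?I \<noteq> {}"
        by (auto intro: exI[of _ 0])
      fix p :: "'k mpoly" assume p: "p \<in> ?I"
      have "p \<in> carrier (poly_ring t)" "- p \<in> carrier (poly_ring t)"
        using polys p uminus_in_polys by (auto simp: poly_ring_def)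
      then have "\<ominus>\<^bsub>poly_ring t\<^esub> p = - p"
        by (intro minus_equality) (simp_all add: poly_ring_def)
      then show "\<ominus>\<^bsub>poly_ring t\<^esub> p \<in> ?I"
        using p by simp
      fix q :: "'k mpoly" assume "q \<in> ?I"
      then show "p \<oplus>\<^bsub>poly_ring t\<^esub> q \<in> ?I"
        using p Poly_Mapping.keys_add[of p q] by (auto simp: poly_ring_def)
    qed
  next
    fix p q :: "'k mpoly" assume "p \<in> ?I" and "q \<in> carrier (poly_ring t)"
    then show "q \<otimes>\<^bsub>poly_ring t\<^esub> p \<in> ?I" "p \<otimes>\<^bsub>poly_ring t\<^esub> q \<in> ?I"
      using mult[of p q] by (simp_all add: poly_ring_def mult.commute)
  qed
qed

text \<open>Exponents are recorded instead of monomials so that they compare directly with the key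
  sets of polynomials. Using this set in place of the generated ideal keeps the division argument
  within linear algebra.\<close>

definition lead_exponents :: "('a::zero \<Rightarrow> 'k::field mpoly) \<Rightarrow> 'a rel \<Rightarrow> 'a set \<Rightarrow> (nat \<Rightarrow>\<^sub>0 nat) set"
  where "lead_exponents \<Phi> r H = {\<nu>. \<exists>h\<in>H. h \<noteq> 0 \<and> LM \<Phi> r h = monomial \<nu>}"

context algebra_of_countable_type
begin

sublocale \<Phi>: Vector_Spaces.linear scale poly_scale \<Phi>
  by (rule linear_\<Phi>)

lemma \<Phi>_eq_iff: "\<Phi> x = \<Phi> y \<longleftrightarrow> x = y"
  using bij_\<Phi> by (simp add: bij_betw_def inj_eq)

lemma \<Phi>_in_polys: "\<Phi> a \<in> polys t"
  using bij_\<Phi> by (auto simp: bij_betw_def)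

lemma keys_\<Phi>_subset: "Poly_Mapping.keys (\<Phi> a) \<subseteq> exponents t"
  using \<Phi>_in_polys by (auto simp: polys_def)

lemma ex_basis_element:
  assumes "\<nu> \<in> exponents t"
  obtains n where "\<Phi> n = monomial \<nu>" and "n \<noteq> 0"
proof -
  have "monomial \<nu> \<in> range \<Phi>"
    using assms bij_\<Phi> by (simp add: bij_betw_def monomial_in_polys)
  then obtain n where n: "\<Phi> n = monomial \<nu>"
    by auto
  moreover from n have "n \<noteq> 0"
    using keys_monomial[of \<nu>, where 'k = 'k] \<Phi>.zero by (metis keys_zero insert_not_empty)
  ultimately show ?thesis
    using that by blast
qed

lemma transport_order_iff: "(\<Phi> x, \<Phi> y) \<in> transport_order \<Phi> r \<longleftrightarrow> (x, y) \<in> r"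
  by (auto simp: transport_order_def \<Phi>_eq_iff)

lemma LM_monomialE:
  assumes "linear_order_on (canonical_basis t \<Phi>) r" and "a \<noteq> 0"
  obtains \<nu> where "LM \<Phi> r a = monomial \<nu>" and "\<nu> \<in> Poly_Mapping.keys (\<Phi> a)"
    and "\<nu> \<in> exponents t"
  using LM_greatest(1)[OF assms] keys_\<Phi>_subset by (auto simp: occurring_monomials_def)

lemma monomial_le_LM:
  assumes "linear_order_on (canonical_basis t \<Phi>) r" and "a \<noteq> 0"
    and "\<nu> \<in> Poly_Mapping.keys (\<Phi> a)"
  shows "(monomial \<nu>, LM \<Phi> r a) \<in> transport_order \<Phi> r"
  using assms by (intro LM_greatest(2)) (simp_all add: occurring_monomials_def)

lemma LM_basis_element:
  assumes lin: "linear_order_on (canonical_basis t \<Phi>) r" and "n \<noteq> 0" "\<Phi> n = monomial \<nu>"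
  shows "LM \<Phi> r n = monomial \<nu>"
proof -
  from lin assms(2) obtain \<mu> where "LM \<Phi> r n = monomial \<mu>" "\<mu> \<in> Poly_Mapping.keys (\<Phi> n)"
    by (rule LM_monomialE)
  then show ?thesis
    using assms(3) by simp
qed

section \<open>Subspaces and division with respect to a well-ordering\<close>

lemma left_ideal_subspace:
  assumes "left_ideal L"
  shows "\<Phi>.vs1.subspace L"
proof (rule \<Phi>.vs1.subspaceI)
  fix c x assume "x \<in> L"
  \<comment> \<open>Scalars act on A as left multiplication by \<open>scale c 1\<close>.\<close>
  then have "scale c 1 * x \<in> L"
    using assms by (simp add: left_ideal_def)
  then show "scale c x \<in> L"
    by (simp flip: scale_mult_left)
qed (use assms in \<open>auto simp: left_ideal_def\<close>)

text \<open>The termination argument of the division algorithm, freed from the division itself.\<close>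

lemma subspace_eq_UNIV:
  assumes wo: "well_order_on (canonical_basis t \<Phi>) r"
    and S: "\<Phi>.vs1.subspace S"
    and lead: "exponents t \<subseteq> lead_exponents \<Phi> r S"
  shows "S = UNIV"
proof -
  have lin: "linear_order_on (canonical_basis t \<Phi>) r" and wf: "wf (r - Id)"
    using wo by (simp_all add: well_order_on_def)
  \<comment> \<open>Well-founded induction on the leading monomial. Since \<open>r\<close> orders
    elements of A, the induction runs over the basis element \<open>n\<close> that represents this
    monomial.\<close>
  have "a \<in> S" if "a \<noteq> 0" "LM \<Phi> r a = \<Phi> n" for a n
    using wf that
  proof (induction n arbitrary: a rule: wf_induct_rule)
    case (less n)
    obtain \<mu> where \<mu>: "LM \<Phi> r a = monomial \<mu>" "\<mu> \<in> Poly_Mapping.keys (\<Phi> a)"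
        "\<mu> \<in> exponents t"
      using lin less.prems(1) by (rule LM_monomialE)
    obtain u where u: "u \<in> S" "u \<noteq> 0" "LM \<Phi> r u = monomial \<mu>"
      using lead \<mu>(3) by (auto simp: lead_exponents_def)
    have u\<mu>: "\<mu> \<in> Poly_Mapping.keys (\<Phi> u)"
      by (rule LM_monomialE[OF lin u(2)]) (simp add: u(3))
    \<comment> \<open>Subtracting \<open>scale c u\<close> cancels the leading term of
      \<open>a\<close>; the denominator is nonzero by the preceding fact.\<close>
    define c where "c = Poly_Mapping.lookup (\<Phi> a) \<mu> / Poly_Mapping.lookup (\<Phi> u) \<mu>"
    define b where "b = a - scale c u"
    have \<Phi>b: "Poly_Mapping.lookup (\<Phi> b) \<nu> =
        Poly_Mapping.lookup (\<Phi> a) \<nu> - c * Poly_Mapping.lookup (\<Phi> u) \<nu>" for \<nu>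
      by (simp add: b_def \<Phi>.diff \<Phi>.scale lookup_minus)
    have "b \<in> S"
    proof (cases "b = 0")
      case True
      then show ?thesis
        using S by (simp add: \<Phi>.vs1.subspace_0)
    next
      case False
      with lin obtain \<nu> where \<nu>: "LM \<Phi> r b = monomial \<nu>" "\<nu> \<in> Poly_Mapping.keys (\<Phi> b)"
          "\<nu> \<in> exponents t"
        by (rule LM_monomialE)
      obtain n' where n': "\<Phi> n' = monomial \<nu>"
        using \<nu>(3) by (rule ex_basis_element)
      have "\<nu> \<noteq> \<mu>"
        using \<nu>(2) u\<mu> by (auto simp: in_keys_iff \<Phi>b c_def)
      then have "n' \<noteq> n"
        using n' \<mu>(1) less.prems(2) by auto
      \<comment> \<open>Each exponent of \<open>b\<close> comes from \<open>a\<close> or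
        \<open>u\<close>. Both have leading exponent \<mu>, so nothing above \<mu> can
        appear.\<close>
      moreover have "\<nu> \<in> Poly_Mapping.keys (\<Phi> a) \<union> Poly_Mapping.keys (\<Phi> u)"
        using \<nu>(2) by (auto simp: in_keys_iff \<Phi>b)
      then have "(monomial \<nu>, \<Phi> n) \<in> transport_order \<Phi> r"
        using monomial_le_LM[OF lin less.prems(1)] monomial_le_LM[OF lin u(2)]
          u(3) \<mu>(1) less.prems(2) by auto
      then have "(n', n) \<in> r"
        unfolding n'[symmetric] transport_order_iff .
      ultimately have "(n', n) \<in> r - Id"
        by simp
      then show ?thesis
        using less.IH False \<nu>(1) n' by simp
    qed
    then have "b + scale c u \<in> S"
      using S u(1) by (simp add: \<Phi>.vs1.subspace_add \<Phi>.vs1.subspace_scale)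
    then show "a \<in> S"
      by (simp add: b_def)
  qed
  moreover have "\<exists>n. LM \<Phi> r a = \<Phi> n" if "a \<noteq> 0" for a
    by (rule LM_monomialE[OF lin that]) (metis ex_basis_element)
  ultimately have "a \<in> S" for a
    using \<Phi>.vs1.subspace_0[OF S] by metis
  then show ?thesis
    by blast
qed

text \<open>Let V be the space of elements with no leading exponent of \<open>L\<close> in their
  support. Then \<open>L\<close> + V attains every leading exponent: those of \<open>L\<close>
  through \<open>L\<close> itself, the others through basis elements lying in V. Hence
  \<open>L\<close> + V is all of A.\<close>

lemma ex_remainder:
  assumes wo: "well_order_on (canonical_basis t \<Phi>) r" and L: "\<Phi>.vs1.subspace L"
  shows "\<exists>g. a - g \<in> L \<and> Poly_Mapping.keys (\<Phi> g) \<inter> lead_exponents \<Phi> r L = {}"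
proof -
  have lin: "linear_order_on (canonical_basis t \<Phi>) r"
    using wo by (simp add: well_order_on_def)
  define E where "E = lead_exponents \<Phi> r L"
  define V where "V = {g. Poly_Mapping.keys (\<Phi> g) \<inter> E = {}}"
  have V_iff: "g \<in> V \<longleftrightarrow> (\<forall>\<nu>\<in>E. Poly_Mapping.lookup (\<Phi> g) \<nu> = 0)" for g
    by (auto simp: V_def in_keys_iff)
  have V: "\<Phi>.vs1.subspace V"
    by (rule \<Phi>.vs1.subspaceI) (simp_all add: V_iff \<Phi>.zero \<Phi>.add \<Phi>.scale lookup_add)
  define S where "S = {x + y |x y. x \<in> L \<and> y \<in> V}"
  have LS: "L \<subseteq> S" and VS: "V \<subseteq> S"
    using \<Phi>.vs1.subspace_0[OF L] \<Phi>.vs1.subspace_0[OF V] by (force simp: S_def)+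
  have "exponents t \<subseteq> lead_exponents \<Phi> r S"
  proof
    fix \<nu> assume \<nu>: "\<nu> \<in> exponents t"
    show "\<nu> \<in> lead_exponents \<Phi> r S"
    proof (cases "\<nu> \<in> E")
      case True
      then show ?thesis
        using LS by (auto simp: E_def lead_exponents_def)
    next
      case False
      obtain n where n: "\<Phi> n = monomial \<nu>" "n \<noteq> 0"
        using \<nu> by (rule ex_basis_element)
      then have "n \<in> S"
        using False VS by (auto simp: V_def)
      then show ?thesis
        using n LM_basis_element[OF lin n(2,1)] by (auto simp: lead_exponents_def)
    qed
  qed
  then have "S = UNIV"
    using \<Phi>.vs1.subspace_sums[OF L V] wo by (intro subspace_eq_UNIV) (simp_all add: S_def)
  then obtain x g where "a = x + g" "x \<in> L" "g \<in> V"
    unfolding S_def by blast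
  then show ?thesis
    by (intro exI[of _ g]) (simp add: V_def E_def)
qed

text \<open>The core argument, phrased for subspaces; products in A matter only for passing between
  leading exponents and ideals.\<close>

lemma lead_exponents_eq:
  assumes lin: "linear_order_on (canonical_basis t \<Phi>) r"
    and wo': "well_order_on (canonical_basis t \<Phi>) r'"
    and L: "\<Phi>.vs1.subspace L"
    and sub: "lead_exponents \<Phi> r L \<subseteq> lead_exponents \<Phi> r' L"
  shows "lead_exponents \<Phi> r L = lead_exponents \<Phi> r' L"
proof (rule antisym[OF sub subsetI], rule ccontr)
  fix \<mu> assume \<mu>': "\<mu> \<in> lead_exponents \<Phi> r' L" and \<mu>: "\<mu> \<notin> lead_exponents \<Phi> r L"
  have "linear_order_on (canonical_basis t \<Phi>) r'"
    using wo' by (simp add: well_order_on_def)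
  then have "\<mu> \<in> exponents t"
    using \<mu>' unfolding lead_exponents_def by (auto elim!: LM_monomialE)
  then obtain n where n: "\<Phi> n = monomial \<mu>"
    by (rule ex_basis_element)
  \<comment> \<open>Divide the basis element of exponent \<mu> by \<open>L\<close> with respect to
    \<open>r'\<close>. The remainder \<open>g\<close> avoids \<mu>, so the \<mu>-term survives in
    \<open>n - g\<close>, which is therefore a nonzero element of \<open>L\<close>.\<close>
  obtain g where g: "n - g \<in> L" "Poly_Mapping.keys (\<Phi> g) \<inter> lead_exponents \<Phi> r' L = {}"
    using ex_remainder[OF wo' L] by blast
  have \<Phi>f: "Poly_Mapping.lookup (\<Phi> (n - g)) \<nu> =
      Poly_Mapping.lookup (monomial \<mu>) \<nu> - Poly_Mapping.lookup (\<Phi> g) \<nu>" for \<nu>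
    by (simp add: \<Phi>.diff lookup_minus n)
  have "Poly_Mapping.lookup (\<Phi> g) \<mu> = 0"
    using g(2) \<mu>' by (auto simp: in_keys_iff)
  then have "Poly_Mapping.lookup (\<Phi> (n - g)) \<mu> \<noteq> 0"
    by (simp add: \<Phi>f monomial_def)
  then have "n - g \<noteq> 0"
    using \<Phi>.zero by (metis lookup_zero)
  with lin obtain \<nu> where \<nu>: "LM \<Phi> r (n - g) = monomial \<nu>"
      "\<nu> \<in> Poly_Mapping.keys (\<Phi> (n - g))"
    by (rule LM_monomialE)
  have "\<nu> \<in> lead_exponents \<Phi> r L"
    using g(1) \<open>n - g \<noteq> 0\<close> \<nu>(1) unfolding lead_exponents_def by blast
  \<comment> \<open>Both alternatives are impossible: \<mu> was chosen outside the leading exponents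
    for \<open>r\<close>, and the support of \<open>g\<close> avoids those for \<open>r'\<close>,
    hence also those for \<open>r\<close>.\<close>
  moreover have "\<nu> = \<mu> \<or> \<nu> \<in> Poly_Mapping.keys (\<Phi> g)"
    using \<nu>(2) by (auto simp: in_keys_iff \<Phi>f monomial_def lookup_single when_def split: if_splits)
  ultimately show False
    using \<mu> g(2) sub by blast
qed

section \<open>From leading exponents to ideals of leading monomials\<close>

lemma LM_ideal_generators:
  assumes lin: "linear_order_on (canonical_basis t \<Phi>) r"
  shows "{LM \<Phi> r h |h. h \<in> H \<and> h \<noteq> 0} = monomial ` lead_exponents \<Phi> r H"
proof -
  have "\<exists>\<nu>. LM \<Phi> r h = monomial \<nu>" if "h \<noteq> 0" for h
    by (rule LM_monomialE[OF lin that]) blast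
  then show ?thesis
    by (simp add: lead_exponents_def image_def set_eq_iff) metis
qed

lemma lead_exponents_subset:
  assumes lin: "linear_order_on (canonical_basis t \<Phi>) r"
  shows "lead_exponents \<Phi> r H \<subseteq> exponents t"
  unfolding lead_exponents_def by (auto elim!: LM_monomialE[OF lin])

text \<open>Left multiplication by the basis element of exponent \<mu> stays in \<open>L\<close>,
  and by multiplicativity it shifts leading exponents by \<mu>.\<close>

lemma lead_exponents_add:
  assumes lin: "linear_order_on (canonical_basis t \<Phi>) r"
    and mult: "multiplicative_on \<Phi> T" "r \<in> T" and L: "left_ideal L"
    and \<mu>: "\<mu> \<in> exponents t" and \<nu>: "\<nu> \<in> lead_exponents \<Phi> r L"
  shows "\<mu> + \<nu> \<in> lead_exponents \<Phi> r L"
proof -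
  obtain n where n: "\<Phi> n = monomial \<mu>" "n \<noteq> 0"
    using \<mu> by (rule ex_basis_element)
  obtain h where h: "h \<in> L" "h \<noteq> 0" "LM \<Phi> r h = monomial \<nu>"
    using \<nu> by (auto simp: lead_exponents_def)
  have "n * h \<noteq> 0" "LM \<Phi> r (n * h) = LM \<Phi> r n * LM \<Phi> r h"
    using mult n(2) h(2) unfolding multiplicative_on_def by blast+
  moreover have "n * h \<in> L"
    using L h(1) by (simp add: left_ideal_def)
  ultimately show ?thesis
    using LM_basis_element[OF lin n(2,1)] h(3)
    by (auto simp: lead_exponents_def monomial_add)
qed

text \<open>The leading exponents absorb addition, so the polynomials supported on them form an
  ideal containing all generators. Thus generating the ideal creates no new monomials.\<close>

lemma monomial_in_LM_ideal_iff:
  assumes lin: "linear_order_on (canonical_basis t \<Phi>) r"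
    and mult: "multiplicative_on \<Phi> T" "r \<in> T" and L: "left_ideal L"
  shows "monomial \<nu> \<in> LM_ideal t \<Phi> r L \<longleftrightarrow> \<nu> \<in> lead_exponents \<Phi> r L"
proof -
  let ?E = "lead_exponents \<Phi> r L"
  interpret cring "poly_ring t :: 'k mpoly ring"
    by (rule cring_poly_ring)
  have "ideal {p. Poly_Mapping.keys p \<subseteq> ?E} (poly_ring t :: 'k mpoly ring)"
    using lead_exponents_subset[OF lin] lead_exponents_add[OF lin mult L]
    by (rule ideal_polys_supported_on)
  then have "LM_ideal t \<Phi> r L \<subseteq> {p. Poly_Mapping.keys p \<subseteq> ?E}"
    unfolding LM_ideal_def LM_ideal_generators[OF lin] by (rule genideal_minimal) auto
  moreover have "monomial ` ?E \<subseteq> carrier (poly_ring t :: 'k mpoly ring)"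
    using lead_exponents_subset[OF lin, of L] by (auto simp: poly_ring_def monomial_in_polys)
  then have "monomial ` ?E \<subseteq> LM_ideal t \<Phi> r L"
    unfolding LM_ideal_def LM_ideal_generators[OF lin] by (rule genideal_self)
  ultimately show ?thesis
    by auto
qed

end

theorem corollary5p3:
  fixes scale :: "'k::field \<Rightarrow> 'a::ring_1 \<Rightarrow> 'a"
    and t :: nat
    and \<Phi> :: "'a \<Rightarrow> 'k mpoly"
    and r r' :: "'a rel"
    and L :: "'a set"
  assumes "algebra_of_countable_type scale t \<Phi>"
    and "well_order_on (canonical_basis t \<Phi>) r"
    and "well_order_on (canonical_basis t \<Phi>) r'"
    and "multiplicative_on \<Phi> {r, r'}"
    and "left_ideal L"
    and "LM_ideal t \<Phi> r L \<subseteq> LM_ideal t \<Phi> r' L"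
  shows "LM_ideal t \<Phi> r L = LM_ideal t \<Phi> r' L"
proof -
  interpret algebra_of_countable_type scale t \<Phi>
    by (rule assms(1))
  have lin: "linear_order_on (canonical_basis t \<Phi>) r" "linear_order_on (canonical_basis t \<Phi>) r'"
    using assms(2,3) by (simp_all add: well_order_on_def)
  \<comment> \<open>Restrict the inclusion of ideals to the monomials they contain.\<close>
  have "lead_exponents \<Phi> r L \<subseteq> lead_exponents \<Phi> r' L"
    using assms(6) monomial_in_LM_ideal_iff[OF lin(1) assms(4) _ assms(5)]
      monomial_in_LM_ideal_iff[OF lin(2) assms(4) _ assms(5)] by blast
  then have "lead_exponents \<Phi> r L = lead_exponents \<Phi> r' L"
    using lin(1) assms(3) left_ideal_subspace[OF assms(5)] by (intro lead_exponents_eq)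
  then show ?thesis
    by (simp add: LM_ideal_def LM_ideal_generators lin)
qed

end
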